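(* Let $H$ be a graph containing a cycle $C$ and two adjacent vertices neither of which has a neighbor in $V(C)$. Then the class of $H$-subdivisions does not have the induced Erdős–Pósa property.
   Context: All graphs are finite and simple. A subdivision of $H$ is a graph obtained from $H$ by repeatedly replacing an edge by a path of length $2$ through a new vertex. An induced subdivision of $H$ in $G$ is an induced subgraph of $G$ isomorphic to a subdivision of $H$. The class of $H$-subdivisions has the induced Erdős–Pósa property if there is a function $f:\mathbb N\to\mathbb R$ such that for every graph $G$ and every positive integer $k$, $G$ contains either $k$ pairwise vertex-disjoint induced subdivisions of $H$ or a set of at most $f(k)$ vertices meeting every induced subdivision of $H$. *)

theory Defs
  imports Complex_Main
begin

type_synonym 'v graph = "'v set \<times> 'v set set"

definition verts :: "'v graph \<Rightarrow> 'v set" where "verts G = fst G"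
definition edges :: "'v graph \<Rightarrow> 'v set set" where "edges G = snd G"

definition wf_graph :: "'v graph \<Rightarrow> bool" where
  "wf_graph G \<longleftrightarrow> finite (verts G) \<and> (\<forall>e\<in>edges G. e \<subseteq> verts G \<and> card e = 2)"

definition adj :: "'v graph \<Rightarrow> 'v \<Rightarrow> 'v \<Rightarrow> bool" where
  "adj G u v \<longleftrightarrow> {u, v} \<in> edges G"

definition graph_iso :: "'a graph \<Rightarrow> 'b graph \<Rightarrow> bool" where
  "graph_iso G H \<longleftrightarrow> (\<exists>f. bij_betw f (verts G) (verts H) \<and>
     (\<forall>x\<in>verts G. \<forall>y\<in>verts G. adj G x y \<longleftrightarrow> adj H (f x) (f y)))"

definition subdiv_step :: "'v graph \<Rightarrow> 'v graph \<Rightarrow> bool" where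
  "subdiv_step G G' \<longleftrightarrow> (\<exists>u v w. {u, v} \<in> edges G \<and> w \<notin> verts G \<and>
      G' = (insert w (verts G), (edges G - {{u, v}}) \<union> {{u, w}, {w, v}}))"

text \<open>The copy of H on the vertex type 'a + nat, which has infinitely many fresh vertices.\<close>
definition lift_graph :: "'a graph \<Rightarrow> ('a + nat) graph" where
  "lift_graph H = (Inl ` verts H, (\<lambda>e. Inl ` e) ` edges H)"

definition is_subdivision_of :: "'b graph \<Rightarrow> 'a graph \<Rightarrow> bool" where
  "is_subdivision_of S H \<longleftrightarrow>
     (\<exists>H0. subdiv_step\<^sup>*\<^sup>* (lift_graph H) H0 \<and> graph_iso H0 S)"

definition induced_subgraph :: "'v graph \<Rightarrow> 'v set \<Rightarrow> 'v graph" where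
  "induced_subgraph G S = (S, {e \<in> edges G. e \<subseteq> S})"

definition induced_subdiv :: "'v graph \<Rightarrow> 'a graph \<Rightarrow> 'v set \<Rightarrow> bool" where
  "induced_subdiv G H S \<longleftrightarrow> S \<subseteq> verts G \<and> is_subdivision_of (induced_subgraph G S) H"

text \<open>Induced Erdos-Posa property for H-subdivisions. Host graphs are taken on vertex type nat,
  which loses no generality since every finite graph is isomorphic to one on nat.\<close>
definition induced_EP :: "'a graph \<Rightarrow> bool" where
  "induced_EP H \<longleftrightarrow> (\<exists>f :: nat \<Rightarrow> real. \<forall>G :: nat graph. \<forall>k::nat.
     wf_graph G \<and> k > 0 \<longrightarrow>
       (\<exists>F. card F = k \<and> pairwise disjnt F \<and> (\<forall>S\<in>F. induced_subdiv G H S))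
     \<or> (\<exists>X. X \<subseteq> verts G \<and> real (card X) \<le> f k \<and>
            (\<forall>S. induced_subdiv G H S \<longrightarrow> S \<inter> X \<noteq> {})))"

definition is_cycle :: "'v graph \<Rightarrow> 'v list \<Rightarrow> bool" where
  "is_cycle G cs \<longleftrightarrow> length cs \<ge> 3 \<and> distinct cs \<and> set cs \<subseteq> verts G \<and>
     (\<forall>i < length cs. adj G (cs ! i) (cs ! ((i + 1) mod length cs)))"

end

theory Submission
  imports Defs "HOL-Library.Countable"
begin

text \<open>Every subdivision of \<open>H\<close> contains a core (a nonempty set of vertices inducing minimum degree at
  least 2, coming from the cycle) that is anticomplete to some edge. Let \<open>R\<close> be \<open>H\<close> with every edge
  subdivided \<open>2 N + 1\<close> times. The host graph consists of \<open>N\<close> copies of \<open>R\<close>, where on each edge of \<open>H\<close>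
  the subdividing vertex number \<open>2 j\<close> of copy \<open>i\<close> is identified with number \<open>2 i\<close> of copy \<open>j\<close>, and
  all other vertices of distinct copies are made adjacent. The shared vertices are independent, so an
  edge has an unshared end, which forces a core anticomplete to it into a single copy of \<open>R\<close>. There
  the core contains an entire subdivided edge of \<open>H\<close>. Two such paths for the same edge of \<open>H\<close> meet in
  a shared vertex, so at most \<open>card (edges H)\<close> induced subdivisions are pairwise disjoint. Each vertex
  lies in at most two of the \<open>N\<close> copies, so a hitting set has at least \<open>N / 2\<close> vertices.\<close>

section \<open>Adjacency in well-formed, induced and lifted graphs\<close>

lemma adj_sym: "adj G x y \<longleftrightarrow> adj G y x"
  by (simp add: adj_def insert_commute)

lemma wf_graph_adjD:
  assumes "wf_graph G" "adj G x y"
  shows "x \<in> verts G" "y \<in> verts G" "x \<noteq> y"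
proof -
  have "{x, y} \<subseteq> verts G" "card {x, y} = 2"
    using assms unfolding wf_graph_def adj_def by blast+
  then show "x \<in> verts G" "y \<in> verts G" "x \<noteq> y" by auto
qed

lemma adj_induced_subgraph: "adj (induced_subgraph G S) x y \<longleftrightarrow> adj G x y \<and> x \<in> S \<and> y \<in> S"
  by (auto simp: adj_def induced_subgraph_def edges_def)

lemma verts_induced_subgraph [simp]: "verts (induced_subgraph G S) = S"
  by (simp add: induced_subgraph_def verts_def)

lemma wf_graph_lift_graph:
  assumes "wf_graph H"
  shows "wf_graph (lift_graph H)"
  using assms unfolding wf_graph_def lift_graph_def verts_def edges_def
  by (auto simp: card_image)

lemma adj_lift_graph [simp]:
  fixes H :: "'a graph"
  shows "adj (lift_graph H) (Inl x) (Inl y) \<longleftrightarrow> adj H x y"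
proof -
  have "adj (lift_graph H) (Inl x) (Inl y) \<longleftrightarrow>
      (Inl ` {x, y} :: ('a + nat) set) \<in> (`) Inl ` edges H"
    unfolding adj_def lift_graph_def edges_def by simp
  also have "\<dots> \<longleftrightarrow> adj H x y"
    unfolding adj_def by (rule inj_image_mem_iff) (simp add: inj_def inj_image_eq_iff)
  finally show ?thesis .
qed

lemma verts_lift_graph [simp]: "verts (lift_graph H) = Inl ` verts H"
  by (simp add: lift_graph_def verts_def)

section \<open>Cores anticomplete to an edge\<close>

text \<open>A cycle enters the proof only through this weaker property, which passes to subdivisions
  without tracking a cyclic order.\<close>

definition min_degree_2 :: "'v graph \<Rightarrow> 'v set \<Rightarrow> bool" where
  "min_degree_2 G D \<longleftrightarrow> D \<subseteq> verts G \<and> D \<noteq> {} \<and>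
     (\<forall>d\<in>D. \<exists>x\<in>D. \<exists>y\<in>D. x \<noteq> y \<and> adj G d x \<and> adj G d y)"

text \<open>The ends automatically lie outside \<open>D\<close>: an end in \<open>D\<close> would be
  a neighbour in \<open>D\<close> of the other end.\<close>

definition far_edge :: "'v graph \<Rightarrow> 'v set \<Rightarrow> 'v \<Rightarrow> 'v \<Rightarrow> bool" where
  "far_edge G D a b \<longleftrightarrow> a \<in> verts G \<and> b \<in> verts G \<and> adj G a b \<and>
     (\<forall>d\<in>D. \<not> adj G a d \<and> \<not> adj G b d)"

lemma min_degree_2_cycle:
  assumes "is_cycle G cs"
  shows "min_degree_2 G (set cs)"
  unfolding min_degree_2_def
proof (intro conjI ballI)
  let ?n = "length cs"
  have n: "?n \<ge> 3" and dist: "distinct cs"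
    and adj: "\<And>i. i < ?n \<Longrightarrow> adj G (cs ! i) (cs ! ((i + 1) mod ?n))"
    using assms by (auto simp: is_cycle_def)
  show "set cs \<subseteq> verts G" using assms by (simp add: is_cycle_def)
  show "set cs \<noteq> {}" using n by auto
  fix d assume "d \<in> set cs"
  then obtain i where i: "i < ?n" "d = cs ! i" by (auto simp: in_set_conv_nth)
  \<comment> \<open>Cyclic predecessor and successor, with wrap-around at both ends of the list;
    they differ because the length is at least 3.\<close>
  define p where "p = (if i = 0 then ?n - 1 else i - 1)"
  define q where "q = (if i = ?n - 1 then 0 else i + 1)"
  have p: "p < ?n" "(p + 1) mod ?n = i" and q: "q < ?n" "(i + 1) mod ?n = q" and "p \<noteq> q"
    using i n by (auto simp: p_def q_def mod_Suc)
  have "adj G d (cs ! p)" using adj[OF p(1)] p(2) i(2) by (simp add: adj_sym)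
  moreover have "adj G d (cs ! q)" using adj[OF i(1)] q(2) i(2) by simp
  moreover have "cs ! p \<noteq> cs ! q"
    using p q \<open>p \<noteq> q\<close> dist by (simp add: nth_eq_iff_index_eq)
  ultimately show "\<exists>x\<in>set cs. \<exists>y\<in>set cs. x \<noteq> y \<and> adj G d x \<and> adj G d y"
    using p(1) q(1) nth_mem by blast
qed

lemma wf_graph_subdiv_step:
  assumes "wf_graph G" "subdiv_step G G'"
  shows "wf_graph G'"
proof -
  obtain u v w where s: "{u, v} \<in> edges G" "w \<notin> verts G"
    "G' = (insert w (verts G), (edges G - {{u, v}}) \<union> {{u, w}, {w, v}})"
    using assms(2) unfolding subdiv_step_def by blast
  have "u \<in> verts G" "v \<in> verts G"
    using wf_graph_adjD[OF assms(1)] s(1) by (auto simp: adj_def)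
  with s assms(1) show ?thesis
    unfolding wf_graph_def by (auto simp: verts_def edges_def card_insert_if)
qed

text \<open>Subdividing an edge inside \<open>D\<close> puts the new vertex into \<open>D\<close>;
  any other edge leaves \<open>D\<close> as it is. If the far edge itself is subdivided, one of its
  halves replaces it.\<close>

lemma far_edge_subdiv_step:
  assumes wf: "wf_graph G" and step: "subdiv_step G G'"
    and D: "min_degree_2 G D" and far: "far_edge G D a b"
  shows "\<exists>D' a' b'. min_degree_2 G' D' \<and> far_edge G' D' a' b'"
proof -
  obtain u v w where uv: "{u, v} \<in> edges G" and w: "w \<notin> verts G" and
    G': "G' = (insert w (verts G), (edges G - {{u, v}}) \<union> {{u, w}, {w, v}})"
    using step unfolding subdiv_step_def by blast
  have uv_verts: "u \<in> verts G" "v \<in> verts G" "u \<noteq> v"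
    using wf_graph_adjD[OF wf] uv by (auto simp: adj_def)
  have verts': "verts G' = insert w (verts G)" by (simp add: G' verts_def)
  have old: "adj G' x y \<longleftrightarrow> adj G x y \<and> {x, y} \<noteq> {u, v}"
    if "x \<in> verts G" "y \<in> verts G" for x y
    using that w by (auto simp: G' adj_def edges_def doubleton_eq_iff)
  have new: "adj G' x w \<longleftrightarrow> x = u \<or> x = v" "adj G' w x \<longleftrightarrow> x = u \<or> x = v" if "x \<in> verts G" for x
    using that w wf_graph_adjD[OF wf, of x w] wf_graph_adjD[OF wf, of w x]
    by (auto simp: G' adj_def edges_def doubleton_eq_iff)
  have DV: "D \<subseteq> verts G" and Dne: "D \<noteq> {}"
    and deg: "\<And>d. d \<in> D \<Longrightarrow> \<exists>x\<in>D. \<exists>y\<in>D. x \<noteq> y \<and> adj G d x \<and> adj G d y"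
    using D by (auto simp: min_degree_2_def)
  have ab: "a \<in> verts G" "b \<in> verts G" "adj G a b" and anti: "\<And>d. d \<in> D \<Longrightarrow> \<not> adj G a d \<and> \<not> adj G b d"
    using far by (auto simp: far_edge_def)
  have abD: "a \<notin> D" "b \<notin> D" using anti ab(3) adj_sym by metis+
  have "w \<notin> D" using DV w by blast
  define D' where "D' = (if u \<in> D \<and> v \<in> D then insert w D else D)"
  have "min_degree_2 G' D'"
    unfolding min_degree_2_def
  proof (intro conjI ballI)
    show "D' \<subseteq> verts G'" "D' \<noteq> {}" using DV Dne by (auto simp: D'_def verts')
    fix d assume d: "d \<in> D'"
    show "\<exists>x\<in>D'. \<exists>y\<in>D'. x \<noteq> y \<and> adj G' d x \<and> adj G' d y"
    proof (cases "d = w")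
      case True
      then have "u \<in> D'" "v \<in> D'" using d \<open>w \<notin> D\<close> by (auto simp: D'_def split: if_splits)
      then show ?thesis using True new uv_verts by blast
    next
      case False
      then have dD: "d \<in> D" using d by (auto simp: D'_def split: if_splits)
      then obtain x y where xy: "x \<in> D" "y \<in> D" "x \<noteq> y" "adj G d x" "adj G d y"
        using deg by blast
      \<comment> \<open>Reroute through w the neighbour that the subdivision cuts off.\<close>
      define r where "r z = (if {d, z} = {u, v} then w else z)" for z
      have r: "r z \<in> D' \<and> adj G' d (r z)" if "z \<in> D" "adj G d z" for z
        using that dD DV new(1)[of d] old[of d z] by (auto simp: r_def D'_def doubleton_eq_iff)
      have "r x \<noteq> r y" using xy \<open>w \<notin> D\<close> by (auto simp: r_def doubleton_eq_iff)
      with r xy show ?thesis by blast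
    qed
  qed
  moreover have "\<exists>a' b'. far_edge G' D' a' b'"
  proof (cases "{a, b} = {u, v}")
    \<comment> \<open>The half \<open>u w\<close> is still far from \<open>D\<close>:
      \<open>u\<close> is one of \<open>a\<close>, \<open>b\<close>, and \<open>w\<close> has only
      the neighbours \<open>u\<close>, \<open>v\<close>, both outside \<open>D\<close>.\<close>
    case True
    then have D'D: "D' = D" using abD by (auto simp: D'_def doubleton_eq_iff)
    have uvD: "u \<notin> D" "v \<notin> D" using True abD by (auto simp: doubleton_eq_iff)
    have "\<not> adj G' u d \<and> \<not> adj G' w d" if "d \<in> D" for d
      using that old[of u d] new(2)[of d] anti[OF that] uvD DV True uv_verts
      by (auto simp: doubleton_eq_iff)
    then have "far_edge G' D' u w"
      using new(1)[of u] uv_verts by (simp add: far_edge_def verts' D'D)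
    then show ?thesis by blast
  next
    case False
    have "\<not> adj G' a d \<and> \<not> adj G' b d" if "d \<in> D'" for d
    proof (cases "d = w")
      case True
      \<comment> \<open>\<open>w\<close> is in \<open>D'\<close> only when both its neighbours are
        in \<open>D\<close>, so neither of them is \<open>a\<close> or \<open>b\<close>.\<close>
      then have "u \<in> D" "v \<in> D" using that \<open>w \<notin> D\<close> by (auto simp: D'_def split: if_splits)
      then show ?thesis using True new(1) ab abD by blast
    next
      case False
      then have "d \<in> D" using that by (auto simp: D'_def split: if_splits)
      then show ?thesis using anti old ab DV by blast
    qed
    then have "far_edge G' D' a b"
      using old ab False by (simp add: far_edge_def verts')
    then show ?thesis by blast
  qed
  ultimately show ?thesis by blast
qed

lemma far_edge_graph_iso:
  assumes "graph_iso G G'" and D: "min_degree_2 G D" and far: "far_edge G D a b"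
  shows "\<exists>D' a' b'. min_degree_2 G' D' \<and> far_edge G' D' a' b'"
proof -
  obtain f where bij: "bij_betw f (verts G) (verts G')"
    and adj: "\<And>x y. x \<in> verts G \<Longrightarrow> y \<in> verts G \<Longrightarrow> adj G' (f x) (f y) \<longleftrightarrow> adj G x y"
    using assms(1) unfolding graph_iso_def by blast
  have DV: "D \<subseteq> verts G" and Dne: "D \<noteq> {}"
    and deg: "\<And>d. d \<in> D \<Longrightarrow> \<exists>x\<in>D. \<exists>y\<in>D. x \<noteq> y \<and> adj G d x \<and> adj G d y"
    using D by (auto simp: min_degree_2_def)
  have im: "f x \<in> verts G'" if "x \<in> verts G" for x using bij that by (rule bij_betwE[rule_format])
  have "min_degree_2 G' (f ` D)"
    unfolding min_degree_2_def
  proof (intro conjI ballI)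
    show "f ` D \<subseteq> verts G'" "f ` D \<noteq> {}" using DV Dne im by auto
    fix d' assume "d' \<in> f ` D"
    then obtain d where d: "d \<in> D" "d' = f d" by blast
    then obtain x y where xy: "x \<in> D" "y \<in> D" "x \<noteq> y" "adj G d x" "adj G d y"
      using deg by blast
    then have "f x \<noteq> f y" using bij DV unfolding bij_betw_def inj_on_def by blast
    moreover have "adj G' d' (f x)" "adj G' d' (f y)" using xy d DV adj by auto
    ultimately show "\<exists>x\<in>f ` D. \<exists>y\<in>f ` D. x \<noteq> y \<and> adj G' d' x \<and> adj G' d' y"
      using xy by blast
  qed
  moreover have "far_edge G' (f ` D) (f a) (f b)"
    using far im adj DV by (auto simp: far_edge_def subset_iff)
  ultimately show ?thesis by blast
qed

text \<open>A core with a far edge is carried along each subdivision step, then along the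
  isomorphism, and finally from the induced subgraph into \<open>G\<close>.\<close>

lemma far_edge_induced_subdiv:
  assumes wf: "wf_graph H" and D: "min_degree_2 H D" and far: "far_edge H D a b"
    and "induced_subdiv G H S"
  shows "\<exists>D' a' b'. D' \<subseteq> S \<and> min_degree_2 G D' \<and> far_edge G D' a' b'"
proof -
  obtain H0 where steps: "subdiv_step\<^sup>*\<^sup>* (lift_graph H) H0" and iso: "graph_iso H0 (induced_subgraph G S)"
    and S: "S \<subseteq> verts G"
    using assms(4) unfolding induced_subdiv_def is_subdivision_of_def by blast
  have "wf_graph H0 \<and> (\<exists>D a b. min_degree_2 H0 D \<and> far_edge H0 D a b)"
    using steps
  proof (induction rule: rtranclp_induct)
    case base
    have "min_degree_2 (lift_graph H) (Inl ` D)"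
      using D unfolding min_degree_2_def bex_simps ball_simps by auto
    moreover have "far_edge (lift_graph H) (Inl ` D) (Inl a) (Inl b)"
      using far by (auto simp: far_edge_def)
    ultimately show ?case using wf_graph_lift_graph[OF wf] by blast
  next
    case (step G1 G2)
    then obtain D a b where "wf_graph G1" "min_degree_2 G1 D" "far_edge G1 D a b" by blast
    with far_edge_subdiv_step[of G1 G2] wf_graph_subdiv_step[of G1 G2] step.hyps(2)
    show ?case by simp
  qed
  then obtain D' a' b' where *: "min_degree_2 (induced_subgraph G S) D'" "far_edge (induced_subgraph G S) D' a' b'"
    using far_edge_graph_iso[OF iso] by blast
  then have "D' \<subseteq> S" by (simp add: min_degree_2_def)
  moreover have "min_degree_2 G D'"
    using *(1) S unfolding min_degree_2_def adj_induced_subgraph verts_induced_subgraph by blast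
  \<comment> \<open>Inducedness matters here: nonadjacency inside \<open>S\<close> is nonadjacency
    in \<open>G\<close>.\<close>
  moreover have "far_edge G D' a' b'"
    using * S \<open>D' \<subseteq> S\<close> by (auto simp: far_edge_def adj_induced_subgraph)
  ultimately show ?thesis by blast
qed

section \<open>Uniform subdivisions\<close>

text \<open>\<open>s\<close> and \<open>t\<close> orient the edges so that positions along a
  subdivided edge can be counted; the numberings \<open>idx\<close> and \<open>h\<close> allow
  vertices to be coded by naturals whatever the vertex type of \<open>H\<close>.\<close>

locale enumerated_graph =
  fixes H :: "'a graph" and s t :: "'a set \<Rightarrow> 'a" and idx :: "'a set \<Rightarrow> nat" and h :: "'a \<Rightarrow> nat"
  assumes wf: "wf_graph H"
    and ends: "e \<in> edges H \<Longrightarrow> e = {s e, t e}"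
    and idx_inj: "inj_on idx (edges H)"
    and h_inj: "inj_on h (verts H)"
begin

lemma finite_verts: "finite (verts H)"
  using wf by (simp add: wf_graph_def)

lemma finite_edges: "finite (edges H)"
  using wf finite_verts by (auto simp: wf_graph_def intro: finite_subset[of _ "Pow (verts H)"])

lemma ends_verts: "e \<in> edges H \<Longrightarrow> s e \<in> verts H" "e \<in> edges H \<Longrightarrow> t e \<in> verts H"
  and ends_neq: "e \<in> edges H \<Longrightarrow> s e \<noteq> t e"
proof -
  assume e: "e \<in> edges H"
  then have "adj H (s e) (t e)" using ends by (simp add: adj_def)
  then show "s e \<in> verts H" "t e \<in> verts H" "s e \<noteq> t e"
    using wf_graph_adjD[OF wf] by blast+
qed

definition inner :: "'a set \<Rightarrow> nat \<Rightarrow> 'a + nat" where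
  "inner e k = Inr (prod_encode (idx e, k))"

text \<open>The path replacing \<open>e\<close> runs from position 0 to position
  \<open>m e + 1\<close>. Its length may depend on \<open>e\<close> so that edges can be subdivided
  one at a time.\<close>

definition node :: "('a set \<Rightarrow> nat) \<Rightarrow> 'a set \<Rightarrow> nat \<Rightarrow> 'a + nat" where
  "node m e k = (if k = 0 then Inl (s e) else if k \<le> m e then inner e k else Inl (t e))"

definition path_edges :: "('a set \<Rightarrow> nat) \<Rightarrow> 'a set \<Rightarrow> ('a + nat) set set" where
  "path_edges m e = (\<lambda>k. {node m e k, node m e (Suc k)}) ` {..m e}"

definition subdivided :: "('a set \<Rightarrow> nat) \<Rightarrow> ('a + nat) graph" where
  "subdivided m = (Inl ` verts H \<union> (\<Union>e\<in>edges H. inner e ` {1..m e}), \<Union>e\<in>edges H. path_edges m e)"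

lemma inner_eq_iff [simp]:
  "e \<in> edges H \<Longrightarrow> e' \<in> edges H \<Longrightarrow> inner e k = inner e' k' \<longleftrightarrow> e = e' \<and> k = k'"
  using idx_inj by (auto simp: inner_def inj_on_def)

lemma inner_neq_Inl [simp]: "inner e k \<noteq> Inl a" "Inl a \<noteq> inner e k"
  by (simp_all add: inner_def)

lemma path_edges_cong: "m e = m' e \<Longrightarrow> path_edges m e = path_edges m' e"
  unfolding path_edges_def node_def by (rule image_cong) simp_all

lemma subdivided_cong: "(\<And>e. e \<in> edges H \<Longrightarrow> m e = m' e) \<Longrightarrow> subdivided m = subdivided m'"
  by (simp add: subdivided_def cong: path_edges_cong)

lemma subdivided_0: "subdivided (\<lambda>_. 0) = lift_graph H"
proof -
  have "path_edges (\<lambda>_. 0) e = {Inl ` e}" if "e \<in> edges H" for e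
    using ends[OF that] by (simp add: path_edges_def node_def) (metis image_empty image_insert)
  then show ?thesis by (auto simp: subdivided_def lift_graph_def)
qed

text \<open>Ensures that deleting the last edge of one path destroys no other edge. The delicate
  case is a path without inner vertices, where the two ends must determine the edge of
  \<open>H\<close>.\<close>

lemma last_edge_notin:
  assumes e: "e \<in> edges H" and e': "e' \<in> edges H" and k: "k \<le> m e'"
    and eq: "{node m e' k, node m e' (Suc k)} = {node m e (m e), Inl (t e)}"
  shows "e' = e \<and> k = m e"
proof -
  have *: "e' = e" if "{s e', t e'} = {s e, t e}"
    using that ends[OF e] ends[OF e'] by simp
  show ?thesis
    using eq k e e' * ends_neq[OF e] ends_neq[OF e']
    by (auto simp: node_def doubleton_eq_iff split: if_splits)
qed

text \<open>The step acts on the last edge of the path, so existing inner vertices keep their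
  numbers and the new one comes at position \<open>Suc (m e)\<close>.\<close>

lemma subdiv_step_subdivided:
  assumes e: "e \<in> edges H"
  shows "subdiv_step (subdivided m) (subdivided (m(e := Suc (m e))))"
proof -
  let ?m = "m(e := Suc (m e))" and ?w = "inner e (Suc (m e))"
  let ?u = "node m e (m e)" and ?v = "Inl (t e)"
  let ?rest = "\<Union>e'\<in>edges H - {e}. path_edges m e'"
  let ?init = "(\<lambda>k. {node m e k, node m e (Suc k)}) ` {..<m e}"
  have split: "path_edges m e = insert {?u, ?v} ?init"
    by (auto simp: path_edges_def node_def lessThan_Suc_atMost[symmetric] lessThan_Suc)
  have split': "path_edges ?m e = {{?u, ?w}, {?w, ?v}} \<union> ?init"
  proof -
    have "{..?m e} = insert (Suc (m e)) (insert (m e) {..<m e})" by auto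
    moreover have "node ?m e k = node m e k" if "k \<le> m e" for k using that by (simp add: node_def)
    moreover have "node ?m e (Suc (m e)) = ?w" "node ?m e (Suc (Suc (m e))) = ?v"
      by (simp_all add: node_def)
    ultimately show ?thesis
      by (simp add: path_edges_def insert_commute cong: image_cong_simp)
  qed
  have E: "edges (subdivided m) = path_edges m e \<union> ?rest"
    using e by (auto simp: subdivided_def edges_def)
  have rest': "path_edges ?m e' = path_edges m e'" if "e' \<noteq> e" for e'
    using that by (simp cong: path_edges_cong)
  have E': "edges (subdivided ?m) = path_edges ?m e \<union> ?rest"
  proof -
    have "edges (subdivided ?m) = path_edges ?m e \<union> (\<Union>e'\<in>edges H - {e}. path_edges ?m e')"
      using e by (auto simp: subdivided_def edges_def)
    then show ?thesis using rest' by simp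
  qed
  have "{?u, ?v} \<notin> ?init"
  proof
    assume "{?u, ?v} \<in> ?init"
    then obtain k where "k < m e" "{node m e k, node m e (Suc k)} = {?u, ?v}" by auto
    then show False using last_edge_notin[OF e e, of k m] by simp
  qed
  moreover have "{?u, ?v} \<notin> ?rest"
  proof
    assume "{?u, ?v} \<in> ?rest"
    then obtain e' k where "e' \<in> edges H" "e' \<noteq> e" "k \<le> m e'"
      "{node m e' k, node m e' (Suc k)} = {?u, ?v}"
      unfolding path_edges_def by auto
    then show False using last_edge_notin[OF e, of e' k m] by simp
  qed
  ultimately have "edges (subdivided ?m) = (edges (subdivided m) - {{?u, ?v}}) \<union> {{?u, ?w}, {?w, ?v}}"
    unfolding E E' split split' by auto
  moreover have "verts (subdivided ?m) = insert ?w (verts (subdivided m))"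
  proof -
    have "(\<Union>e'\<in>edges H. inner e' ` {1..?m e'}) = insert ?w (\<Union>e'\<in>edges H. inner e' ` {1..m e'})"
    proof -
      have "inner e' ` {1..?m e'} = (if e' = e then insert ?w (inner e' ` {1..m e'}) else inner e' ` {1..m e'})"
        for e' by (simp add: atLeastAtMostSuc_conv)
      then show ?thesis using e by auto
    qed
    then show ?thesis by (simp add: subdivided_def verts_def)
  qed
  moreover have "{?u, ?v} \<in> edges (subdivided m)" by (simp add: E split)
  moreover have "?w \<notin> verts (subdivided m)"
    using e by (auto simp: subdivided_def verts_def)
  ultimately show ?thesis
    unfolding subdiv_step_def by (metis edges_def verts_def prod.collapse)
qed

lemma subdivided_add:
  assumes e: "e \<in> edges H"
  shows "subdiv_step\<^sup>*\<^sup>* (subdivided m) (subdivided (m(e := m e + k)))"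
proof (induction k)
  case (Suc k)
  have "(m(e := m e + k))(e := Suc ((m(e := m e + k)) e)) = m(e := m e + Suc k)" by simp
  then show ?case
    using Suc subdiv_step_subdivided[OF e, of "m(e := m e + k)"] rtranclp.rtrancl_into_rtrancl by metis
qed simp

text \<open>Edges are treated one after another; in the induction \<open>F\<close> collects those
  already subdivided \<open>M\<close> times.\<close>

lemma subdivided_reachable: "subdiv_step\<^sup>*\<^sup>* (lift_graph H) (subdivided (\<lambda>_. M))"
proof -
  have "subdiv_step\<^sup>*\<^sup>* (lift_graph H) (subdivided (\<lambda>e. if e \<in> F then M else 0))"
    if "F \<subseteq> edges H" for F
    using finite_subset[OF that finite_edges] that
  proof (induction F rule: finite_induct)
    case empty
    then show ?case by (simp add: subdivided_0)
  next
    case (insert e F)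
    let ?m = "\<lambda>e. if e \<in> F then M else 0"
    have "?m(e := ?m e + M) = (\<lambda>e'. if e' \<in> insert e F then M else 0)"
      using insert.hyps by auto
    then show ?case
      using insert subdivided_add[of e ?m M] by (auto intro: rtranclp_trans)
  qed
  from this[of "edges H"] show ?thesis
    using subdivided_cong[of "\<lambda>e. if e \<in> edges H then M else 0" "\<lambda>_. M"] by simp
qed


section \<open>Sets of minimum degree 2 in a subdivision\<close>

lemma adj_subdividedE:
  assumes "adj (subdivided m) x y"
  obtains e k where "e \<in> edges H" "k \<le> m e" "{x, y} = {node m e k, node m e (Suc k)}"
proof -
  have "\<exists>e\<in>edges H. \<exists>k\<le>m e. {x, y} = {node m e k, node m e (Suc k)}"
    using assms unfolding adj_def subdivided_def edges_def path_edges_def by auto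
  then show thesis using that by blast
qed

lemma adj_inner:
  assumes e: "e \<in> edges H" and k: "1 \<le> k" "k \<le> m e" and adj: "adj (subdivided m) (inner e k) y"
  shows "y = node m e (k - 1) \<or> y = node m e (Suc k)"
proof -
  obtain e' k' where *: "e' \<in> edges H" "k' \<le> m e'"
    "{inner e k, y} = {node m e' k', node m e' (Suc k')}"
    using adj by (rule adj_subdividedE)
  then have "e' = e \<and> (k' = k \<and> y = node m e (Suc k) \<or> Suc k' = k \<and> y = node m e k')"
    using e k by (auto simp: node_def doubleton_eq_iff split: if_splits)
  then show ?thesis by auto
qed

lemma wf_graph_subdivided: "wf_graph (subdivided m)"
proof -
  have "node m e k \<noteq> node m e (Suc k)" if "e \<in> edges H" "k \<le> m e" for e k
    using that ends_neq[OF that(1)] by (auto simp: node_def)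
  moreover have "node m e k \<in> verts (subdivided m)" if "e \<in> edges H" for e k
    using ends_verts[OF that] that
    by (cases "k = 0 \<or> m e < k") (auto 0 3 simp: node_def subdivided_def verts_def)
  moreover have "finite (verts (subdivided m))"
    using finite_verts finite_edges by (simp add: subdivided_def verts_def)
  ultimately show ?thesis
    unfolding wf_graph_def by (auto simp: subdivided_def edges_def path_edges_def)
qed

text \<open>Branch vertices are pairwise nonadjacent once every edge is subdivided, so
  \<open>D\<close> contains an inner vertex. Having only two neighbours, it forces both into
  \<open>D\<close>, and this spreads along the whole path.\<close>

lemma min_degree_2_contains_path:
  assumes D: "min_degree_2 (subdivided m) D" and m: "\<And>e. m e \<ge> 1"
  shows "\<exists>e\<in>edges H. \<forall>k\<in>{1..m e}. inner e k \<in> D"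
proof -
  obtain d where d: "d \<in> D" using D by (auto simp: min_degree_2_def)
  have "\<exists>e\<in>edges H. \<exists>k\<in>{1..m e}. inner e k \<in> D"
  proof (cases d)
    case (Inl a)
    obtain x where x: "x \<in> D" "adj (subdivided m) d x"
      using D d unfolding min_degree_2_def by blast
    obtain e k where *: "e \<in> edges H" "k \<le> m e" "{d, x} = {node m e k, node m e (Suc k)}"
      using x(2) by (rule adj_subdividedE)
    then have "x = inner e k \<and> k \<in> {1..m e} \<or> x = inner e (Suc k) \<and> Suc k \<in> {1..m e}"
      using Inl m[of e] by (auto simp: node_def doubleton_eq_iff split: if_splits)
    then show ?thesis using * x by blast
  next
    case (Inr n)
    then show ?thesis
      using D d by (fastforce simp: min_degree_2_def subdivided_def verts_def)
  qed
  then obtain e k0 where e: "e \<in> edges H" and k0: "k0 \<in> {1..m e}" "inner e k0 \<in> D" by blast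
  have nbrs: "node m e (k - 1) \<in> D \<and> node m e (Suc k) \<in> D"
    if k: "k \<in> {1..m e}" "inner e k \<in> D" for k
  proof -
    obtain x y where "x \<in> D" "y \<in> D" "x \<noteq> y"
      "adj (subdivided m) (inner e k) x" "adj (subdivided m) (inner e k) y"
      using D k(2) unfolding min_degree_2_def by blast
    then show ?thesis using adj_inner[OF e, of k m] k(1) by auto
  qed
  have up: "inner e k \<in> D" if "k0 \<le> k" "k \<le> m e" for k
    using that
  proof (induction k rule: dec_induct)
    case (step k)
    then show ?case using nbrs[of k] k0(1) by (simp add: node_def)
  qed (use k0 in simp)
  have down: "inner e k \<in> D" if "k \<le> k0" "1 \<le> k" for k
    using that
  proof (induction k rule: inc_induct)
    case (step k)
    then show ?case using nbrs[of "Suc k"] k0(1) by (simp add: node_def)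
  qed (use k0 in simp)
  show ?thesis using e up down by (metis atLeastAtMost_iff nat_le_linear)
qed

subsection \<open>The host graph\<close>

text \<open>Inner vertices at even positions are the ones open to identification. Position
  \<open>2 * i\<close> of copy \<open>i\<close> counts as shared too, although it lies in that copy
  only.\<close>

definition unshared :: "'a + nat \<Rightarrow> bool" where
  "unshared r \<longleftrightarrow> (case r of Inl a \<Rightarrow> True | Inr n \<Rightarrow> odd (snd (prod_decode n)))"

text \<open>Position r in the i-th copy of the subdivided graph. The inner vertex with number 2 * j in
  copy i coincides with the inner vertex with number 2 * i in copy j.\<close>
definition place :: "nat \<Rightarrow> 'a + nat \<Rightarrow> nat" where
  "place i r = to_nat (case r of Inl a \<Rightarrow> [0, i, h a] | Inr n \<Rightarrow>
     if unshared r then [1, i, n]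
     else [2, fst (prod_decode n), set_encode {i, snd (prod_decode n) div 2}])"

text \<open>The even inner positions are 2, 4, ..., \<open>2 * N\<close>, one for each of the
  \<open>N\<close> copies.\<close>

definition template :: "nat \<Rightarrow> ('a + nat) graph" where
  "template N = subdivided (\<lambda>_. 2 * N + 1)"

text \<open>Shared vertices get no cross edges: as a vertex of its second copy, such a vertex would
  be joined to the first copy and spoil its inducedness.\<close>

definition host :: "nat \<Rightarrow> nat graph" where
  "host N = ((\<Union>i\<in>{1..N}. place i ` verts (template N)),
     (\<Union>i\<in>{1..N}. (\<lambda>e. place i ` e) ` edges (template N)) \<union>
     {{place i r, place i' r'} | i i' r r'. i \<in> {1..N} \<and> i' \<in> {1..N} \<and> i \<noteq> i' \<and>
        r \<in> verts (template N) \<and> r' \<in> verts (template N) \<and> unshared r \<and> unshared r'})"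

section \<open>Coding of positions in the copies\<close>

lemma wf_graph_template: "wf_graph (template N)"
  by (simp add: template_def wf_graph_subdivided)

lemma Inl_template: "Inl a \<in> verts (template N) \<Longrightarrow> a \<in> verts H"
  by (auto simp: template_def subdivided_def verts_def)

lemma unshared_Inl [simp]: "unshared (Inl a)"
  by (simp add: unshared_def)

lemma unshared_inner [simp]: "unshared (inner e k) \<longleftrightarrow> odd k"
  by (simp add: unshared_def inner_def)

text \<open>Consecutive positions differ in parity and branch vertices are unshared, so the shared
  vertices are independent.\<close>

lemma adj_template_unshared:
  assumes "adj (template N) x y"
  shows "unshared x \<or> unshared y"
  using assms unfolding template_def
  by (rule adj_subdividedE) (auto simp: node_def doubleton_eq_iff split: if_splits)

text \<open>The code of an unshared position stores the copy index and starts with 0 or 1, never 2,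
  so it agrees neither with a shared code nor with one from another copy.\<close>

lemma place_unshared_eq:
  assumes "unshared r" "place i r = place i' r'" "r \<in> verts (template N)" "r' \<in> verts (template N)"
  shows "i = i' \<and> r = r'"
proof (cases r)
  case (Inl a)
  then obtain a' where "r' = Inl a'" "i = i'" "h a = h a'"
    using assms(2) by (auto simp: place_def split: sum.splits if_splits)
  then show ?thesis using Inl assms(3,4) Inl_template h_inj by (metis inj_onD)
next
  case (Inr n)
  then show ?thesis
    using assms(1,2) by (auto simp: place_def split: sum.splits if_splits)
qed

text \<open>The code of a shared position stores the unordered pair of copy indices. If two such
  pairs agree while \<open>i \<noteq> i'\<close>, each position must point to the other
  copy.\<close>

lemma place_shared:
  assumes "place i r = place i' r'" "i \<noteq> i'" "r \<in> verts (template N)" "r' \<in> verts (template N)"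
  shows "\<exists>c. r = Inr (prod_encode (c, 2 * i')) \<and> r' = Inr (prod_encode (c, 2 * i))"
proof -
  have np: "\<not> unshared r" "\<not> unshared r'"
    using assms place_unshared_eq by metis+
  then obtain n n' where n: "r = Inr n" "r' = Inr n'"
    by (metis unshared_Inl sumE)
  obtain c k c' k' where ck: "prod_decode n = (c, k)" "prod_decode n' = (c', k')" by fastforce
  then have "n = prod_encode (c, k)" "n' = prod_encode (c', k')" by (metis prod_decode_inverse)+
  moreover have "even k" "even k'" using np n ck by (auto simp: unshared_def)
  moreover have "c = c'" "{i, k div 2} = {i', k' div 2}"
    using assms(1) np ck unfolding n by (auto simp: place_def set_encode_eq)
  then have "k div 2 = i'" "k' div 2 = i" using assms(2) by (auto simp: doubleton_eq_iff)
  ultimately show ?thesis using n \<open>c = c'\<close> by (metis dvd_mult_div_cancel)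
qed

lemma place_inj: "inj_on (place i) (verts (template N))"
proof (rule inj_onI)
  fix r r' assume rr': "r \<in> verts (template N)" "r' \<in> verts (template N)" "place i r = place i r'"
  show "r = r'"
  proof (cases "unshared r \<or> unshared r'")
    case True
    then show ?thesis using place_unshared_eq rr' by metis
  next
    case False
    then obtain n n' where n: "r = Inr n" "r' = Inr n'"
      by (metis unshared_Inl sumE)
    obtain c k c' k' where ck: "prod_decode n = (c, k)" "prod_decode n' = (c', k')" by fastforce
    have "even k" "even k'" using False n ck by (auto simp: unshared_def)
    moreover have "c = c'" "{i, k div 2} = {i, k' div 2}"
      using rr'(3) False ck unfolding n by (auto simp: place_def set_encode_eq)
    \<comment> \<open>Doubletons with a common element agree only if their other entries agree, also
      when one of these is \<open>i\<close> itself.\<close>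
    then have "k div 2 = k' div 2" by (auto simp: doubleton_eq_iff)
    ultimately show ?thesis using n ck \<open>c = c'\<close> by (metis dvd_mult_div_cancel prod_decode_inverse)
  qed
qed

text \<open>The crossing of two copies of one subdivided edge: the code depends only on
  \<open>e\<close> and on the unordered pair of \<open>i\<close> and \<open>j\<close>.\<close>

lemma place_inner_swap: "place i (inner e (2 * j)) = place j (inner e (2 * i))"
  by (simp add: place_def inner_def unshared_def insert_commute)

section \<open>Edges of the host graph\<close>

lemma adj_hostE:
  assumes "adj (host N) x y"
  obtains (copy) i r r' where "i \<in> {1..N}" "adj (template N) r r'" "x = place i r" "y = place i r'"
  | (cross) i i' r r' where "i \<in> {1..N}" "i' \<in> {1..N}" "i \<noteq> i'" "r \<in> verts (template N)"
      "r' \<in> verts (template N)" "unshared r" "unshared r'" "x = place i r" "y = place i' r'"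
proof -
  consider i e where "i \<in> {1..N}" "e \<in> edges (template N)" "{x, y} = place i ` e"
    | i i' r r' where "i \<in> {1..N}" "i' \<in> {1..N}" "i \<noteq> i'" "r \<in> verts (template N)"
      "r' \<in> verts (template N)" "unshared r" "unshared r'" "{x, y} = {place i r, place i' r'}"
    using assms unfolding adj_def host_def edges_def by auto
  then show ?thesis
  proof cases
    case 1
    then have "card e = 2" using wf_graph_template unfolding wf_graph_def by blast
    then obtain r r' where e: "e = {r, r'}" by (meson card_2_iff)
    have "adj (template N) r r'" "adj (template N) r' r" using 1 e by (auto simp: adj_def insert_commute)
    moreover have "x = place i r \<and> y = place i r' \<or> x = place i r' \<and> y = place i r"
      using 1(3) e by (auto simp: doubleton_eq_iff)
    ultimately show ?thesis using copy 1(1) by blast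
  next
    case 2
    then have "x = place i r \<and> y = place i' r' \<or> x = place i' r' \<and> y = place i r"
      by (auto simp: doubleton_eq_iff)
    then show ?thesis using cross 2 by metis
  qed
qed

lemma adj_host_copy: "i \<in> {1..N} \<Longrightarrow> adj (template N) r r' \<Longrightarrow> adj (host N) (place i r) (place i r')"
  unfolding adj_def host_def edges_def snd_conv
  by (intro UnI1 UN_I image_eqI[of _ _ "{r, r'}"]) simp_all

lemma adj_host_cross:
  "i \<in> {1..N} \<Longrightarrow> i' \<in> {1..N} \<Longrightarrow> i \<noteq> i' \<Longrightarrow> r \<in> verts (template N) \<Longrightarrow> r' \<in> verts (template N) \<Longrightarrow>
   unshared r \<Longrightarrow> unshared r' \<Longrightarrow> adj (host N) (place i r) (place i' r')"
  unfolding adj_def host_def edges_def snd_conv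
  by (intro UnI2 CollectI exI conjI) (rule refl, assumption+)

lemma place_in_host: "i \<in> {1..N} \<Longrightarrow> r \<in> verts (template N) \<Longrightarrow> place i r \<in> verts (host N)"
  by (auto simp: host_def verts_def)

lemma wf_graph_host: "wf_graph (host N)"
proof -
  have adj: "x \<in> verts (host N) \<and> y \<in> verts (host N) \<and> x \<noteq> y" if "adj (host N) x y" for x y
    using that
  proof (cases rule: adj_hostE)
    case (copy i r r')
    then show ?thesis
      using wf_graph_adjD[OF wf_graph_template copy(2)] place_in_host place_inj[of i N]
      by (auto simp: inj_on_def)
  next
    case (cross i i' r r')
    then show ?thesis using place_in_host place_unshared_eq by blast
  qed
  have "e \<subseteq> verts (host N) \<and> card e = 2" if "e \<in> edges (host N)" for e
  proof -
    have "\<exists>x y. e = {x, y}"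
    proof -
      have "\<exists>r r'. e' = {r, r'}" if "e' \<in> edges (template N)" for e'
        using that wf_graph_template unfolding wf_graph_def by (meson card_2_iff)
      then show ?thesis using that unfolding host_def edges_def by fastforce
    qed
    then obtain x y where "e = {x, y}" by blast
    with that adj[of x y] show ?thesis by (simp add: adj_def)
  qed
  moreover have "finite (verts (host N))"
    using wf_graph_template by (simp add: host_def verts_def wf_graph_def)
  ultimately show ?thesis by (simp add: wf_graph_def)
qed

text \<open>The host adds no edge inside copy \<open>i\<close>: an edge of a copy has an unshared
  end, which identifies that copy as \<open>i\<close>, and a cross edge has unshared ends in two
  distinct copies.\<close>

lemma induced_subdiv_copy:
  assumes i: "i \<in> {1..N}"
  shows "induced_subdiv (host N) H (place i ` verts (template N))"
proof -
  let ?S = "place i ` verts (template N)"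
  have adj: "adj (template N) x y"
    if xy: "x \<in> verts (template N)" "y \<in> verts (template N)" and "adj (host N) (place i x) (place i y)" for x y
    using that(3)
  proof (cases rule: adj_hostE)
    case (copy j r r')
    have rr': "r \<in> verts (template N)" "r' \<in> verts (template N)"
      using wf_graph_adjD[OF wf_graph_template copy(2)] by auto
    have "j = i"
      using adj_template_unshared[OF copy(2)] copy rr' xy place_unshared_eq by metis
    then show ?thesis using copy rr' xy place_inj[of i N] by (metis inj_onD)
  next
    case (cross j j' r r')
    then show ?thesis using xy place_unshared_eq by metis
  qed
  have "graph_iso (template N) (induced_subgraph (host N) ?S)"
    unfolding graph_iso_def
  proof (intro exI[of _ "place i"] conjI ballI)
    show "bij_betw (place i) (verts (template N)) (verts (induced_subgraph (host N) ?S))"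
      using place_inj by (simp add: bij_betw_def)
  next
    fix x y assume "x \<in> verts (template N)" "y \<in> verts (template N)"
    then show "adj (template N) x y = adj (induced_subgraph (host N) ?S) (place i x) (place i y)"
      using adj adj_host_copy[OF i] by (auto simp: adj_induced_subgraph)
  qed
  then have "is_subdivision_of (induced_subgraph (host N) ?S) H"
    unfolding is_subdivision_of_def template_def using subdivided_reachable by blast
  then show ?thesis
    using place_in_host i by (auto simp: induced_subdiv_def)
qed

section \<open>Hitting sets and packings\<close>

text \<open>Double counting over \<open>X\<close>: a vertex lies in at most two copies, because its
  position in one copy determines the index of any other copy containing it.\<close>

lemma card_hitting_set:
  assumes "finite X" and hit: "\<And>i. i \<in> {1..N} \<Longrightarrow> place i ` verts (template N) \<inter> X \<noteq> {}"
  shows "N \<le> 2 * card X"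
proof -
  let ?I = "\<lambda>x. {i \<in> {1..N}. x \<in> place i ` verts (template N)}"
  have two: "card (?I x) \<le> 2" for x
  proof (rule ccontr)
    assume "\<not> card (?I x) \<le> 2"
    then have "3 \<le> card (?I x)" by simp
    then obtain J where "J \<subseteq> ?I x" "card J = 3"
      by (rule obtain_subset_with_card_n)
    from \<open>card J = 3\<close> obtain i j k where "J = {i, j, k}" and ijk: "i \<noteq> j" "i \<noteq> k" "j \<noteq> k"
      unfolding card_3_iff by blast
    with \<open>J \<subseteq> ?I x\<close> have "i \<in> ?I x" "j \<in> ?I x" "k \<in> ?I x" by blast+
    then obtain r r' r'' where r: "r \<in> verts (template N)" "r' \<in> verts (template N)" "r'' \<in> verts (template N)"
      "x = place i r" "x = place j r'" "x = place k r''" by auto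
    then obtain c c' where "r = Inr (prod_encode (c, 2 * j))" "r = Inr (prod_encode (c', 2 * k))"
      using place_shared[of i r j r' N] place_shared[of i r k r'' N] ijk by auto
    then show False using ijk(3) by simp
  qed
  have "{1..N} \<subseteq> (\<Union>x\<in>X. ?I x)" using hit by fastforce
  then have "card {1..N} \<le> card (\<Union>x\<in>X. ?I x)"
    using assms(1) by (intro card_mono) auto
  also have "\<dots> \<le> (\<Sum>x\<in>X. card (?I x))" by (rule card_UN_le[OF assms(1)])
  also have "\<dots> \<le> (\<Sum>x\<in>X. 2)" by (rule sum_mono) (rule two)
  finally show ?thesis by simp
qed

text \<open>An unshared end of the far edge, in copy \<open>i\<close>, is adjacent to all unshared
  vertices of other copies, so the unshared vertices of \<open>D\<close> lie in copy
  \<open>i\<close>. Every edge inside \<open>D\<close> then lies in copy \<open>i\<close>, and by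
  the degree condition so does \<open>D\<close>.\<close>

lemma min_degree_2_far_edge_host:
  assumes D: "min_degree_2 (host N) D" and far: "far_edge (host N) D a b"
  shows "\<exists>e\<in>edges H. \<exists>i\<in>{1..N}. \<forall>j\<in>{1..N}. place i (inner e (2 * j)) \<in> D"
proof -
  have "\<exists>i\<in>{1..N}. \<exists>r\<in>verts (template N). unshared r \<and> (a = place i r \<or> b = place i r)"
  proof -
    have "adj (host N) a b" using far by (simp add: far_edge_def)
    then show ?thesis
    proof (cases rule: adj_hostE)
      case (copy i r r')
      then show ?thesis
        using adj_template_unshared[OF copy(2)] wf_graph_adjD[OF wf_graph_template copy(2)] by blast
    qed blast
  qed
  then obtain i r0 where i: "i \<in> {1..N}" and r0: "r0 \<in> verts (template N)" "unshared r0"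
    "a = place i r0 \<or> b = place i r0" by blast
  have only: "j = i" if "j \<in> {1..N}" "r \<in> verts (template N)" "unshared r" "place j r \<in> D" for j r
  proof (rule ccontr)
    assume "j \<noteq> i"
    then have "adj (host N) (place i r0) (place j r)"
      using adj_host_cross i that r0 by metis
    then show False using far that(4) r0(3) by (auto simp: far_edge_def)
  qed
  have in_copy: "\<exists>r r'. adj (template N) r r' \<and> x = place i r \<and> y = place i r'"
    if xy: "x \<in> D" "y \<in> D" and "adj (host N) x y" for x y
    using that(3)
  proof (cases rule: adj_hostE)
    case (copy j r r')
    then have "j = i"
      using adj_template_unshared[OF copy(2)] wf_graph_adjD[OF wf_graph_template copy(2)] only xy by blast
    then show ?thesis using copy by blast
  next
    case (cross j j' r r')
    then show ?thesis using only xy by blast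
  qed
  have deg: "\<exists>x\<in>D. \<exists>y\<in>D. x \<noteq> y \<and> adj (host N) d x \<and> adj (host N) d y" if "d \<in> D" for d
    using D that by (simp add: min_degree_2_def)
  \<comment> \<open>Pulled back to the template, the core keeps minimum degree 2, since edges inside
    \<open>D\<close> come from edges of copy \<open>i\<close>.\<close>
  define D' where "D' = {r \<in> verts (template N). place i r \<in> D}"
  have "min_degree_2 (template N) D'"
    unfolding min_degree_2_def
  proof (intro conjI ballI)
    show "D' \<subseteq> verts (template N)" by (auto simp: D'_def)
    obtain d x where "d \<in> D" "x \<in> D" "adj (host N) d x"
      using D deg unfolding min_degree_2_def by blast
    then show "D' \<noteq> {}"
      using in_copy[of d x] wf_graph_adjD[OF wf_graph_template] by (fastforce simp: D'_def)
  next
    fix r assume "r \<in> D'"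
    then have r: "r \<in> verts (template N)" "place i r \<in> D" by (auto simp: D'_def)
    have nb: "\<exists>z'\<in>D'. adj (template N) r z' \<and> z = place i z'" if "z \<in> D" "adj (host N) (place i r) z" for z
    proof -
      have "\<exists>q z'. adj (template N) q z' \<and> place i r = place i q \<and> z = place i z'"
        using in_copy[OF r(2)] that by simp
      then obtain q z' where *: "adj (template N) q z'" "place i r = place i q" "z = place i z'"
        by blast
      then have "q \<in> verts (template N)" "z' \<in> verts (template N)"
        using wf_graph_adjD[OF wf_graph_template] by blast+
      moreover from this have "q = r" using * r place_inj[of i N] by (metis inj_onD)
      ultimately show ?thesis using * that by (auto simp: D'_def)
    qed
    then show "\<exists>x\<in>D'. \<exists>y\<in>D'. x \<noteq> y \<and> adj (template N) r x \<and> adj (template N) r y"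
      using deg[OF r(2)] by metis
  qed
  then obtain e where e: "e \<in> edges H" and all: "\<forall>k\<in>{1..2 * N + 1}. inner e k \<in> D'"
    using min_degree_2_contains_path[of "\<lambda>_. 2 * N + 1" D'] unfolding template_def by auto
  \<comment> \<open>Only the even positions are kept, since these are where copies meet.\<close>
  have "place i (inner e (2 * j)) \<in> D" if "j \<in> {1..N}" for j
    using that all by (auto simp: D'_def)
  then show ?thesis using e i by blast
qed

theorem not_induced_EP:
  assumes D: "min_degree_2 H D" and far: "far_edge H D a b"
  shows "\<not> induced_EP H"
proof
  assume "induced_EP H"
  then obtain f :: "nat \<Rightarrow> real" where f: "\<And>(G :: nat graph) k. wf_graph G \<Longrightarrow> k > 0 \<Longrightarrow>
       (\<exists>F. card F = k \<and> pairwise disjnt F \<and> (\<forall>S\<in>F. induced_subdiv G H S))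
     \<or> (\<exists>X. X \<subseteq> verts G \<and> real (card X) \<le> f k \<and> (\<forall>S. induced_subdiv G H S \<longrightarrow> S \<inter> X \<noteq> {}))"
    unfolding induced_EP_def by blast
  \<comment> \<open>One more than the number of edges, so that among \<open>k\<close> induced
    subdivisions two contain a path for the same edge of \<open>H\<close>.\<close>
  define k where "k = Suc (card (edges H))"
  \<comment> \<open>Chosen so that a hitting set of at most \<open>f k\<close> vertices violates
    \<open>N \<le> 2 * card X\<close>.\<close>
  obtain N :: nat where N: "real N > 2 * f k" using reals_Archimedean2 by blast
  have "k > 0" by (simp add: k_def)
  from f[OF wf_graph_host[of N] this] show False
  proof
    assume "\<exists>F. card F = k \<and> pairwise disjnt F \<and> (\<forall>S\<in>F. induced_subdiv (host N) H S)"
    then obtain F where F: "card F = k" "pairwise disjnt F" "\<forall>S\<in>F. induced_subdiv (host N) H S"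
      by blast
    have "\<forall>S\<in>F. \<exists>e. e \<in> edges H \<and> (\<exists>i\<in>{1..N}. \<forall>j\<in>{1..N}. place i (inner e (2 * j)) \<in> S)"
    proof
      fix S assume "S \<in> F"
      with F(3) have "induced_subdiv (host N) H S" by blast
      from far_edge_induced_subdiv[OF wf D far this]
      obtain D' a' b' where "D' \<subseteq> S" "min_degree_2 (host N) D'" "far_edge (host N) D' a' b'"
        by blast
      then show "\<exists>e. e \<in> edges H \<and> (\<exists>i\<in>{1..N}. \<forall>j\<in>{1..N}. place i (inner e (2 * j)) \<in> S)"
        using min_degree_2_far_edge_host[of N D' a' b'] by blast
    qed
    then obtain g where g: "\<And>S. S \<in> F \<Longrightarrow> g S \<in> edges H"
      "\<And>S. S \<in> F \<Longrightarrow> \<exists>i\<in>{1..N}. \<forall>j\<in>{1..N}. place i (inner (g S) (2 * j)) \<in> S"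
      by metis
    have "\<not> inj_on g F"
      using card_inj_on_le[of g F "edges H"] finite_edges g(1) F(1) by (auto simp: k_def)
    then obtain S S' where S: "S \<in> F" "S' \<in> F" "S \<noteq> S'" "g S = g S'"
      by (auto simp: inj_on_def)
    obtain i i' where i: "i \<in> {1..N}" "\<forall>j\<in>{1..N}. place i (inner (g S) (2 * j)) \<in> S"
      and i': "i' \<in> {1..N}" "\<forall>j\<in>{1..N}. place i' (inner (g S) (2 * j)) \<in> S'"
      using g(2)[OF S(1)] g(2)[OF S(2)] S(4) by auto
    \<comment> \<open>Position \<open>2 * i'\<close> of copy \<open>i\<close> is position
      \<open>2 * i\<close> of copy \<open>i'\<close>, so both paths contain it; this covers
      \<open>i = i'\<close> as well.\<close>
    have "place i (inner (g S) (2 * i')) \<in> S \<inter> S'"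
      using i i' place_inner_swap by auto
    then show False using F(2) S unfolding pairwise_def disjnt_def by blast
  next
    assume "\<exists>X. X \<subseteq> verts (host N) \<and> real (card X) \<le> f k \<and>
      (\<forall>S. induced_subdiv (host N) H S \<longrightarrow> S \<inter> X \<noteq> {})"
    then obtain X where X: "X \<subseteq> verts (host N)" "real (card X) \<le> f k"
      "\<forall>S. induced_subdiv (host N) H S \<longrightarrow> S \<inter> X \<noteq> {}"
      by blast
    have "finite X" using X(1) wf_graph_host[of N] finite_subset unfolding wf_graph_def by blast
    then have "N \<le> 2 * card X" using card_hitting_set[of X N] X(3) induced_subdiv_copy by blast
    then show False using X(2) N by linarith
  qed
qed

end

theorem mainTheorem5:
  fixes H :: "'a graph" and C :: "'a list" and u v :: 'a
  assumes "wf_graph H"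
    and "is_cycle H C"
    and "adj H u v"
    and "\<forall>w\<in>set C. \<not> adj H u w \<and> \<not> adj H v w"
  shows "\<not> induced_EP H"
proof -
  have fin: "finite (verts H)" "finite (edges H)"
    using assms(1) by (auto simp: wf_graph_def intro: finite_subset[of _ "Pow (verts H)"])
  have "\<forall>e\<in>edges H. \<exists>x y. e = {x, y}"
    using assms(1) unfolding wf_graph_def by (meson card_2_iff)
  then obtain s t where st: "\<And>e. e \<in> edges H \<Longrightarrow> e = {s e, t e}" by metis
  \<comment> \<open>As \<open>H\<close> is finite, numberings of its vertices and edges exist over
    any type.\<close>
  obtain h :: "'a \<Rightarrow> nat" where h: "inj_on h (verts H)"
    using finite_imp_inj_to_nat_seg[OF fin(1)] by blast
  obtain idx :: "'a set \<Rightarrow> nat" where idx: "inj_on idx (edges H)"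
    using finite_imp_inj_to_nat_seg[OF fin(2)] by blast
  interpret enumerated_graph H s t idx h
    by unfold_locales (fact assms(1) st h idx)+
  have "far_edge H (set C) u v"
    using assms(3,4) wf_graph_adjD[OF assms(1,3)] by (simp add: far_edge_def)
  then show ?thesis using not_induced_EP min_degree_2_cycle[OF assms(2)] by blast
qed

end
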